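(* Let $G$ be a DAG. Then $G$ has the global pairwise-lca-property if and only if $G$ has the global lca-property.
   Context: A DAG is a finite directed graph without loops and without directed cycles. For a DAG $G$ and $u,v\in V(G)$, write $u\preceq_G v$ if there is a directed path from $v$ to $u$ (in particular $v\preceq_G v$); then $v$ is an ancestor of $u$. For a non-empty $A\subseteq V(G)$, a common ancestor of $A$ is a vertex $v$ with $a\preceq_G v$ for all $a\in A$; $\mathrm{LCA}_G(A)$ denotes the set of $\preceq_G$-minimal common ancestors of $A$. $G$ has the global lca-property if $|\mathrm{LCA}_G(A)|=1$ for every non-empty $A\subseteq V(G)$, and the global pairwise-lca-property if $|\mathrm{LCA}_G(A)|=1$ for every $A\subseteq V(G)$ with $|A|=2$. *)

theory Defs
  imports "Graph_Theory.Arc_Walk"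
begin

text \<open>The locale \<^locale>\<open>digraph\<close> already provides finiteness and excludes loops and parallel
  arcs. As there, the null graph is allowed.\<close>

locale dag = digraph +
  assumes no_cycle: "\<not> cycle p"

text \<open>\<^prop>\<open>ancestor_le G u v\<close> is $u \preceq_G v$: note that the path runs from \<open>v\<close> to \<open>u\<close>.
  The empty path at a vertex makes the relation reflexive on the vertices.\<close>

definition ancestor_le :: "('a, 'b) pre_digraph \<Rightarrow> 'a \<Rightarrow> 'a \<Rightarrow> bool" where
  "ancestor_le G u v \<longleftrightarrow> (\<exists>p. pre_digraph.apath G v p u)"

definition common_ancestors :: "('a, 'b) pre_digraph \<Rightarrow> 'a set \<Rightarrow> 'a set" where
  "common_ancestors G A = {v \<in> verts G. \<forall>a\<in>A. ancestor_le G a v}"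

definition LCA :: "('a, 'b) pre_digraph \<Rightarrow> 'a set \<Rightarrow> 'a set" where
  "LCA G A = {v \<in> common_ancestors G A.
     \<not> (\<exists>w \<in> common_ancestors G A. ancestor_le G w v \<and> w \<noteq> v)}"

definition global_lca_property :: "('a, 'b) pre_digraph \<Rightarrow> bool" where
  "global_lca_property G \<longleftrightarrow> (\<forall>A. A \<subseteq> verts G \<and> A \<noteq> {} \<longrightarrow> card (LCA G A) = 1)"

definition global_pairwise_lca_property :: "('a, 'b) pre_digraph \<Rightarrow> bool" where
  "global_pairwise_lca_property G \<longleftrightarrow>
     (\<forall>A. A \<subseteq> verts G \<and> card A = 2 \<longrightarrow> card (LCA G A) = 1)"

end

theory Submission
  imports Defs
begin

text \<open>In a finite partial order a set has exactly one minimal element iff it has a least element.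
  So the common ancestors of a set \<open>F\<close> are the ancestors of its unique lca \<open>l\<close>, and the common
  ancestors of \<open>insert a F\<close> are those of \<open>{a, l}\<close>.\<close>

context dag
begin

lemma ancestor_le_iff_reachable: "ancestor_le G u v \<longleftrightarrow> v \<rightarrow>\<^sup>* u"
  by (simp add: ancestor_le_def reachable_apath)

lemma ancestor_le_refl: "v \<in> verts G \<Longrightarrow> ancestor_le G v v"
  by (simp add: ancestor_le_iff_reachable)

lemma ancestor_le_trans: "ancestor_le G u v \<Longrightarrow> ancestor_le G v w \<Longrightarrow> ancestor_le G u w"
  by (auto simp: ancestor_le_iff_reachable intro: reachable_trans)

text \<open>This is where acyclicity enters: walks both ways between distinct vertices join to a
  non-empty closed walk, and such a walk yields a cycle.\<close>

lemma ancestor_le_antisym: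
  assumes "ancestor_le G u v" "ancestor_le G v u"
  shows "u = v"
proof (rule ccontr)
  assume "u \<noteq> v"
  obtain p q where p: "awalk v p u" and q: "awalk u q v"
    using assms by (auto simp: ancestor_le_iff_reachable reachable_awalk)
  have "p \<noteq> []"
    using p \<open>u \<noteq> v\<close> by (auto simp: awalk_ends)
  moreover have "awalk v (p @ q) v"
    using p q by (rule awalk_appendI)
  ultimately have "closed_w (p @ q)"
    by (auto simp: closed_w_def)
  then show False
    using no_cycle closed_w_imp_cycle by blast
qed

lemma common_ancestors_subset: "common_ancestors G A \<subseteq> verts G"
  by (auto simp: common_ancestors_def)

text \<open>Holds by finiteness of the vertex set. It turns uniqueness of the minimal common
  ancestor into leastness.\<close>

lemma ex_LCA_below:
  assumes "v \<in> common_ancestors G A"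
  shows "\<exists>m \<in> LCA G A. ancestor_le G m v"
proof -
  let ?S = "{w \<in> common_ancestors G A. ancestor_le G w v}"
  have "finite ?S"
    by (rule finite_subset[OF _ finite_verts]) (use common_ancestors_subset in blast)
  moreover have "v \<in> ?S"
    using assms common_ancestors_subset ancestor_le_refl by auto
  moreover have "asymp_on ?S (\<lambda>x y. ancestor_le G x y \<and> x \<noteq> y)"
    by (rule asymp_onI) (blast dest: ancestor_le_antisym)
  moreover have "transp_on ?S (\<lambda>x y. ancestor_le G x y \<and> x \<noteq> y)"
    by (rule transp_onI) (blast dest: ancestor_le_antisym intro: ancestor_le_trans)
  ultimately have "\<exists>m \<in> ?S. \<forall>w \<in> ?S. w \<noteq> m \<longrightarrow> \<not> (ancestor_le G w m \<and> w \<noteq> m)"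
    by (intro Finite_Set.bex_min_element) auto
  then obtain m where "m \<in> ?S" and min: "\<And>w. w \<in> ?S \<Longrightarrow> ancestor_le G w m \<Longrightarrow> w = m"
    by blast
  \<comment> \<open>By transitivity through \<open>m\<close>, a common ancestor below
    \<open>m\<close> lies in \<open>?S\<close>, so minimality in \<open>?S\<close> is minimality
    among all common ancestors.\<close>
  then have "w = m" if "w \<in> common_ancestors G A" "ancestor_le G w m" for w
    using that ancestor_le_trans[of w m v] by simp
  with \<open>m \<in> ?S\<close> have "m \<in> LCA G A"
    by (auto simp: LCA_def)
  with \<open>m \<in> ?S\<close> show ?thesis by blast
qed

text \<open>Common ancestors are closed under passing to further ancestors, so having a least
  element \<open>l\<close> means being exactly the set of ancestors of \<open>l\<close>. In this
  form \<open>l\<close> can stand in for all of \<open>A\<close>.\<close>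

lemma card_LCA_eq_1_iff:
  "card (LCA G A) = 1 \<longleftrightarrow>
     (\<exists>l \<in> verts G. \<forall>v \<in> verts G. v \<in> common_ancestors G A \<longleftrightarrow> ancestor_le G l v)"
  (is "?card \<longleftrightarrow> ?least")
proof
  assume ?card
  then obtain l where l: "LCA G A = {l}"
    by (auto simp: card_1_singleton_iff)
  then have "l \<in> common_ancestors G A"
    by (auto simp: LCA_def)
  moreover have "ancestor_le G l v" if "v \<in> common_ancestors G A" for v
    using ex_LCA_below[OF that] l by simp
  moreover have "v \<in> common_ancestors G A" if "v \<in> verts G" "ancestor_le G l v" for v
    using \<open>l \<in> common_ancestors G A\<close> that
    by (auto simp: common_ancestors_def intro: ancestor_le_trans)
  ultimately show ?least
    using common_ancestors_subset by blast
next
  assume ?least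
  then obtain l where l: "l \<in> verts G"
      "\<And>v. v \<in> verts G \<Longrightarrow> v \<in> common_ancestors G A \<longleftrightarrow> ancestor_le G l v"
    by blast
  then have "l \<in> common_ancestors G A"
    using ancestor_le_refl by blast
  moreover have "ancestor_le G l v" if "v \<in> common_ancestors G A" for v
    using l(2)[of v] that common_ancestors_subset by blast
  ultimately have "LCA G A = {l}"
    unfolding LCA_def by (blast dest: ancestor_le_antisym)
  then show ?card by simp
qed

lemma card_LCA_singleton: "a \<in> verts G \<Longrightarrow> card (LCA G {a}) = 1"
  unfolding card_LCA_eq_1_iff by (auto simp: common_ancestors_def)

lemma global_lca_if_pairwise:
  assumes pairwise: "global_pairwise_lca_property G"
  shows "global_lca_property G"
proof -
  have "card (LCA G A) = 1" if "finite A" "A \<noteq> {}" "A \<subseteq> verts G" for A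
    using that
  proof (induction A rule: finite_ne_induct)
    case (singleton a)
    then show ?case by (simp add: card_LCA_singleton)
  next
    case (insert a F)
    then obtain l where l: "l \<in> verts G"
        "\<And>v. v \<in> verts G \<Longrightarrow> v \<in> common_ancestors G F \<longleftrightarrow> ancestor_le G l v"
      unfolding card_LCA_eq_1_iff by blast
    have "common_ancestors G (insert a F) = common_ancestors G {a, l}"
      using l(2) by (auto simp: common_ancestors_def)
    \<comment> \<open>\<open>LCA\<close> depends on its set argument only through
      \<open>common_ancestors\<close>.\<close>
    then have "LCA G (insert a F) = LCA G {a, l}"
      by (simp add: LCA_def)
    moreover have "card (LCA G {a, l}) = 1"
    \<comment> \<open>If \<open>a = l\<close>, the pair collapses to a singleton, about which the
      pairwise property says nothing.\<close>
    proof (cases "a = l")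
      case True
      then show ?thesis using l by (simp add: card_LCA_singleton)
    next
      case False
      then show ?thesis
        using pairwise insert.prems l by (simp add: global_pairwise_lca_property_def)
    qed
    ultimately show ?case by simp
  qed
  then show ?thesis
    by (auto simp: global_lca_property_def intro: finite_subset[OF _ finite_verts])
qed

end

theorem theorem3p6:
  fixes G :: "('a, 'b) pre_digraph"
  assumes "dag G"
  shows "global_pairwise_lca_property G \<longleftrightarrow> global_lca_property G"
proof
  assume "global_pairwise_lca_property G"
  then show "global_lca_property G"
    by (rule dag.global_lca_if_pairwise[OF assms])
next
  assume "global_lca_property G"
  then show "global_pairwise_lca_property G"
    unfolding global_lca_property_def global_pairwise_lca_property_def
    \<comment> \<open>A set of cardinality 2 is non-empty.\<close>
    by (metis card.empty zero_neq_numeral)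
qed

end
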